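(* Let $N\ge2$, $s\in(0,1)$ and $p\le0$. Let $\mathcal I$ be any of the operators $\mathcal I_k^{+}$, $\mathcal I_k^-$ with $k=1,\dots,N$. Let $C>0$ and $0<\alpha<\frac{2s}{1-p}$ be constants. Then there is no function $u$ satisfying all of the following: $$\begin{cases}u\in LSC(\mathbb{R}^N_+)\cap\mathcal S,\\ u\ge0 & \text{in }\mathbb{R}^N\setminus\mathbb{R}^N_+,\\ 0<u(x)\le C(1+|x|)^\alpha & \text{for }x\in\mathbb{R}^N_+,\\ \mathcal Iu+u^p\le0 & \text{in }\mathbb{R}^N_+\ \text{in the viscosity sense}.\end{cases}$$
   Context: $\mathbb{R}^N_+=\{x=(x',x_N)\in\mathbb{R}^{N-1}\times\mathbb{R}: x_N>0\}$. For a unit vector $\xi\in\mathbb{R}^N$, $$\mathcal I_\xi u(x)=C_s\int_0^{+\infty}\frac{u(x+\tau\xi)+u(x-\tau\xi)-2u(x)}{\tau^{1+2s}}\,d\tau,$$ where $C_s>0$ is a normalizing constant depending only on $s$ (chosen so that $\mathcal I_\xi u(x)\to\langle D^2u(x)\xi,\xi\rangle$ as $s\to1^-$). $\mathcal V_k$ is the set of $k$-element orthonormal families $\{\xi_1,\dots,\xi_k\}$ in $\mathbb{R}^N$, and $$\mathcal I_k^-u(x)=\inf_{\{\xi_i\}\in\mathcal V_k}\sum_{i=1}^k\mathcal I_{\xi_i}u(x),\qquad \mathcal I_k^+u(x)=\sup_{\{\xi_i\}\in\mathcal V_k}\sum_{i=1}^k\mathcal I_{\xi_i}u(x).$$ $\mathcal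 S$ is the space of functions $u:\mathbb{R}^N\to\mathbb{R}$ such that (i) for every $x\in\mathbb{R}^N_+$ and unit vector $\xi$, the map $\tau\in\mathbb{R}\mapsto u(x+\tau\xi)$ is measurable; (ii) there are $\alpha'\in[0,2s)$ and $C'>0$ with $|u(x)|\le C'(1+|x|)^{\alpha'}$ for all $x\in\mathbb{R}^N$. $LSC(\mathbb{R}^N_+)$ means lower semicontinuous on $\mathbb{R}^N_+$. Viscosity sense: for $u\in\mathcal S\cap LSC(\mathbb{R}^N_+)$ with $u>0$ in $\mathbb{R}^N_+$, $\mathcal I u+u^p\le0$ in $\mathbb{R}^N_+$ in the viscosity sense means that for every $x_0\in\mathbb{R}^N_+$, $r>0$ with $B_r(x_0)\subseteq\mathbb{R}^N_+$ and $\varphi\in C^2(\overline{B_r(x_0)})$ with $\varphi(x_0)=u(x_0)$ and $\varphi\le u$ in $B_r(x_0)$, the function $\psi$ equal to $\varphi$ in $B_r(x_0)$ and to $u$ in $\mathbb{R}^N\setminus B_r(x_0)$ satisfies $\mathcal I\psi(x_0)+u(x_0)^p\le 0$. *)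

theory Defs
  imports "HOL-Analysis.Analysis"
begin

text \<open>\<open>\<real>\<^sup>N\<close> is modelled as \<open>\<real>\<^sup>N\<^sup>-\<^sup>1 \<times> \<real>\<close>, the type \<open>(real^'m) \<times> real\<close> with its Euclidean
  norm, so \<open>x = (x', x\<^sub>N)\<close> has \<open>x\<^sub>N = snd x\<close> and \<open>N = CARD('m) + 1 \<ge> 2\<close>.\<close>

definition half_space :: "((real^'m) \<times> real) set" where
  "half_space = {x. snd x > 0}"

text \<open>\<open>c\<close> is the constant \<open>C\<^sub>s\<close>. The integral is a Lebesgue integral. It converges absolutely
  at \<open>x\<close> whenever \<open>u\<close> is \<open>C\<^sup>2\<close> near \<open>x\<close>, measurable along the line through \<open>x\<close> and bounded by
  \<open>C' (1 + norm y) powr a\<close> with \<open>a < 2 s\<close>, in particular for the functions that occur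
  in \<open>viscosity_supersolution\<close> below.\<close>

definition frac_dir ::
  "real \<Rightarrow> real \<Rightarrow> 'a::real_normed_vector \<Rightarrow> ('a \<Rightarrow> real) \<Rightarrow> 'a \<Rightarrow> real" where
  "frac_dir c s \<xi> u x =
     c * (LINT \<tau>:{0<..}|lebesgue.
            (u (x + \<tau> *\<^sub>R \<xi>) + u (x - \<tau> *\<^sub>R \<xi>) - 2 * u x) / \<tau> powr (1 + 2 * s))"

definition orthonormal_families :: "nat \<Rightarrow> 'a::euclidean_space set set" where
  "orthonormal_families k =
     {B. finite B \<and> card B = k \<and> pairwise orthogonal B \<and> (\<forall>\<xi>\<in>B. norm \<xi> = 1)}"

text \<open>The infimum and supremum are taken in \<open>real\<close>. At the functions in
  \<open>viscosity_supersolution\<close> the directional integrals are bounded uniformly in the direction,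
  so for \<open>1 \<le> k \<le> N\<close> they are over nonempty bounded sets.\<close>

definition frac_inf ::
  "real \<Rightarrow> real \<Rightarrow> nat \<Rightarrow> ('a::euclidean_space \<Rightarrow> real) \<Rightarrow> 'a \<Rightarrow> real" where
  "frac_inf c s k u x = (INF B\<in>orthonormal_families k. \<Sum>\<xi>\<in>B. frac_dir c s \<xi> u x)"

definition frac_sup ::
  "real \<Rightarrow> real \<Rightarrow> nat \<Rightarrow> ('a::euclidean_space \<Rightarrow> real) \<Rightarrow> 'a \<Rightarrow> real" where
  "frac_sup c s k u x = (SUP B\<in>orthonormal_families k. \<Sum>\<xi>\<in>B. frac_dir c s \<xi> u x)"

text \<open>\<open>g\<close> is the gradient of \<open>f\<close> and \<open>H\<close> its Hessian on the open set \<open>U\<close>.\<close>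

definition has_grad_hess ::
  "('a::euclidean_space \<Rightarrow> real) \<Rightarrow> ('a \<Rightarrow> 'a) \<Rightarrow> ('a \<Rightarrow> 'a \<Rightarrow>\<^sub>L 'a) \<Rightarrow> 'a set \<Rightarrow> bool" where
  "has_grad_hess f g H U \<longleftrightarrow>
     (\<forall>x\<in>U. (f has_derivative (\<lambda>h. g x \<bullet> h)) (at x) \<and>
             (g has_derivative blinfun_apply (H x)) (at x))"

text \<open>\<open>f \<in> C\<^sup>2(closure U)\<close> for open \<open>U\<close>: \<open>f\<close> is twice differentiable in \<open>U\<close>, and \<open>f\<close> and its
  derivatives up to order two are (extend to) continuous functions on the closure.\<close>

definition C2_on_closure :: "'a::euclidean_space set \<Rightarrow> ('a \<Rightarrow> real) \<Rightarrow> bool" where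
  "C2_on_closure U f \<longleftrightarrow>
     continuous_on (closure U) f \<and>
     (\<exists>g H. continuous_on (closure U) g \<and> continuous_on (closure U) H \<and> has_grad_hess f g H U)"

text \<open>The map \<open>s \<mapsto> C\<^sub>s\<close> is positive and chosen so that the directional operators tend to
  \<open>\<langle>D\<^sup>2u(x) \<xi>, \<xi>\<rangle>\<close> as \<open>s \<rightarrow> 1\<^sup>-\<close>, for bounded \<open>u\<close> of class \<open>C\<^sup>2\<close>. Such maps exist, for example
  \<open>C\<^sub>s = 2 (1 - s)\<close>.\<close>

definition normalizing_constant :: "'a::euclidean_space itself \<Rightarrow> (real \<Rightarrow> real) \<Rightarrow> bool" where
  "normalizing_constant _ Cs \<longleftrightarrow>
     (\<forall>s. 0 < s \<and> s < 1 \<longrightarrow> Cs s > 0) \<and>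
     (\<forall>(u::'a \<Rightarrow> real) g H x \<xi>.
        bounded (range u) \<and> continuous_on UNIV H \<and> has_grad_hess u g H UNIV \<and> norm \<xi> = 1 \<longrightarrow>
        ((\<lambda>s. frac_dir (Cs s) s \<xi> u x) \<longlongrightarrow> H x \<xi> \<bullet> \<xi>) (at_left 1))"

definition growth_space :: "real \<Rightarrow> ((real^'m) \<times> real \<Rightarrow> real) set" where
  "growth_space s =
     {u. (\<forall>x\<in>half_space. \<forall>\<xi>. norm \<xi> = 1 \<longrightarrow>
            (\<lambda>\<tau>::real. u (x + \<tau> *\<^sub>R \<xi>)) \<in> borel_measurable lebesgue) \<and>
         (\<exists>\<alpha>' C'. 0 \<le> \<alpha>' \<and> \<alpha>' < 2 * s \<and> C' > 0 \<and>
            (\<forall>x. \<bar>u x\<bar> \<le> C' * (1 + norm x) powr \<alpha>'))}"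

definition LSC :: "'a::topological_space set \<Rightarrow> ('a \<Rightarrow> real) set" where
  "LSC S = {u. \<forall>x\<in>S. \<forall>t<u x. \<forall>\<^sub>F y in at x within S. t < u y}"

text \<open>\<open>\<I> u + u\<^sup>p \<le> 0\<close> in the half space in the viscosity sense, for functions \<open>u\<close> positive there;
  \<open>\<I>\<close> is an arbitrary operator.\<close>

definition viscosity_supersolution ::
  "(((real^'m) \<times> real \<Rightarrow> real) \<Rightarrow> (real^'m) \<times> real \<Rightarrow> real) \<Rightarrow> real \<Rightarrow>
   ((real^'m) \<times> real \<Rightarrow> real) \<Rightarrow> bool" where
  "viscosity_supersolution \<I> p u \<longleftrightarrow>
     (\<forall>x\<^sub>0\<in>half_space. \<forall>r>0. \<forall>\<phi>.
        ball x\<^sub>0 r \<subseteq> half_space \<and> C2_on_closure (ball x\<^sub>0 r) \<phi> \<and>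
        \<phi> x\<^sub>0 = u x\<^sub>0 \<and> (\<forall>x\<in>ball x\<^sub>0 r. \<phi> x \<le> u x) \<longrightarrow>
        \<I> (\<lambda>x. if x \<in> ball x\<^sub>0 r then \<phi> x else u x) x\<^sub>0 + u x\<^sub>0 powr p \<le> 0)"

end

theory Submission
  imports Defs
begin

text \<open>The argument is a scaling argument with a paraboloid. In a ball of radius \<open>R / 2\<close> around
  \<open>(0, R)\<close> the function \<open>u\<close> is at most \<open>A = C (3 R) powr \<alpha>\<close>. The paraboloid of height \<open>A\<close>
  that vanishes on the boundary of this ball, moved down by some \<open>m \<ge> 0\<close>, touches \<open>u\<close> from below
  inside the ball. Since \<open>u \<ge> 0\<close> everywhere, it lies below \<open>u\<close> on the whole space, so at the
  touching point every directional operator is at least a constant times \<open>- A / R powr (2 s)\<close>.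
  As \<open>p \<le> 0\<close>, the inequality forces \<open>A powr p\<close> to be at most a constant times
  \<open>A / R powr (2 s)\<close>, which fails for large \<open>R\<close> because \<open>\<alpha> (1 - p) < 2 s\<close>.\<close>

section \<open>Touching a lower semicontinuous function from below\<close>

text \<open>If no minimum were attained, each \<open>x\<close> would have some \<open>y x\<close>
  with a smaller value, and lower semicontinuity would keep \<open>f\<close> above
  \<open>f (y x)\<close> near \<open>x\<close>. Finitely many of these neighbourhoods cover
  \<open>K\<close>. The lowest of the corresponding points \<open>y x\<close> lies in one of them,
  so another \<open>y w\<close> has a still smaller value.\<close>

lemma lsc_attains_min:
  fixes f :: "'a::topological_space \<Rightarrow> real"
  assumes "compact K" "K \<noteq> {}" and lsc: "\<And>x t. x \<in> K \<Longrightarrow> t < f x \<Longrightarrow> \<forall>\<^sub>F y in at x within K. t < f y"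
  obtains x where "x \<in> K" "\<And>y. y \<in> K \<Longrightarrow> f x \<le> f y"
proof (rule ccontr)
  assume "\<not> thesis"
  then have "\<exists>y\<in>K. f y < f x" if "x \<in> K" for x
    using that \<open>\<And>x. \<lbrakk>x \<in> K; \<And>y. y \<in> K \<Longrightarrow> f x \<le> f y\<rbrakk> \<Longrightarrow> thesis\<close> not_le by blast
  then obtain y where y: "y x \<in> K" "f (y x) < f x" if "x \<in> K" for x
    by metis
  have "\<exists>S. open S \<and> x \<in> S \<and> (\<forall>w\<in>S \<inter> K. f (y x) < f w)" if x: "x \<in> K" for x
  proof -
    obtain S where "open S" "x \<in> S" "\<forall>w\<in>S. w \<noteq> x \<longrightarrow> w \<in> K \<longrightarrow> f (y x) < f w"
      using lsc[OF x y(2)[OF x]] unfolding eventually_at_topological by blast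
    \<comment> \<open>The filter \<open>at x within K\<close> omits \<open>x\<close> itself; there
      the inequality is the choice of \<open>y x\<close>.\<close>
    then show ?thesis
      using y(2)[OF x] by (intro exI[of _ S]) auto
  qed
  then have "\<forall>x\<in>K. \<exists>S. open S \<and> x \<in> S \<and> (\<forall>w\<in>S \<inter> K. f (y x) < f w)"
    by blast
  from bchoice[OF this] obtain S
    where S: "\<forall>x\<in>K. open (S x) \<and> x \<in> S x \<and> (\<forall>w\<in>S x \<inter> K. f (y x) < f w)"
    by blast
  obtain D where D: "D \<subseteq> K" "finite D" "K \<subseteq> (\<Union>x\<in>D. S x)"
    using compactE_image[OF \<open>compact K\<close>, of K S] S by blast
  then have "D \<noteq> {}"
    using \<open>K \<noteq> {}\<close> by blast
  then obtain x where x: "x \<in> D" "\<And>w. w \<in> D \<Longrightarrow> f (y x) \<le> f (y w)"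
    using arg_min_if_finite(1)[of D "\<lambda>x. f (y x)"] arg_min_least[of D _ "\<lambda>x. f (y x)"] \<open>finite D\<close> by blast
  then obtain w where "w \<in> D" "y x \<in> S w"
    using D y(1) by blast
  then have "f (y w) < f (y x)"
    using x(1) D(1) S y(1) by blast
  then show False
    using x(2)[OF \<open>w \<in> D\<close>] by simp
qed

text \<open>Subtract the paraboloid \<open>h\<close> from \<open>u\<close> and minimise over the
  closed ball. At the centre \<open>h\<close> equals \<open>A\<close>, so the minimum is at most 0;
  on the sphere \<open>h\<close> vanishes while \<open>u\<close> is positive, so the minimiser is
  interior. The downward shift \<open>m\<close> is minus the minimum.\<close>

lemma touching_paraboloid:
  fixes u :: "'a::euclidean_space \<Rightarrow> real"
  assumes u: "u \<in> LSC S" and S: "cball z \<rho> \<subseteq> S" and "\<rho> > 0"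
    and pos: "\<And>x. x \<in> cball z \<rho> \<Longrightarrow> 0 < u x" and "u z \<le> A"
  obtains x\<^sub>0 m where "x\<^sub>0 \<in> ball z \<rho>" "m \<ge> 0" "u x\<^sub>0 = A * (1 - (norm (x\<^sub>0 - z) / \<rho>)\<^sup>2) - m"
    "\<And>x. x \<in> ball z \<rho> \<Longrightarrow> A * (1 - (norm (x - z) / \<rho>)\<^sup>2) - m \<le> u x"
proof -
  define h where "h x = A * (1 - (norm (x - z) / \<rho>)\<^sup>2)" for x
  have lsc: "\<forall>\<^sub>F y in at x within cball z \<rho>. t < u y - h y"
    if x: "x \<in> cball z \<rho>" and t: "t < u x - h x" for x t
  proof -
    \<comment> \<open>Half of the gap is allotted to the drop of \<open>u\<close> and half to the
      rise of \<open>h\<close>.\<close>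
    define e where "e = (u x - h x - t) / 2"
    have "e > 0" using t by (simp add: e_def)
    have "\<forall>\<^sub>F y in at x within S. u x - e < u y"
      using u x S \<open>e > 0\<close> by (auto simp: LSC_def)
    then have 1: "\<forall>\<^sub>F y in at x within cball z \<rho>. u x - e < u y"
      using at_le[OF S, of x] by (auto simp: le_filter_def)
    have "(h \<longlongrightarrow> h x) (at x within cball z \<rho>)"
      unfolding h_def using \<open>\<rho> > 0\<close> by (intro tendsto_intros) auto
    then have 2: "\<forall>\<^sub>F y in at x within cball z \<rho>. h y < h x + e"
      using \<open>e > 0\<close> by (simp add: order_tendstoD(2))
    show ?thesis
      using 1 2 by eventually_elim (simp add: e_def field_simps)
  qed
  obtain x\<^sub>0 where x0: "x\<^sub>0 \<in> cball z \<rho>" "\<And>y. y \<in> cball z \<rho> \<Longrightarrow> u x\<^sub>0 - h x\<^sub>0 \<le> u y - h y"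
    using lsc_attains_min[of "cball z \<rho>" "\<lambda>x. u x - h x"] lsc \<open>\<rho> > 0\<close> by auto
  have "u x\<^sub>0 - h x\<^sub>0 \<le> u z - h z"
    using x0(2)[of z] \<open>\<rho> > 0\<close> by simp
  then have le0: "u x\<^sub>0 - h x\<^sub>0 \<le> 0"
    using \<open>u z \<le> A\<close> by (simp add: h_def)
  have "dist z x\<^sub>0 \<noteq> \<rho>"
    using le0 pos[OF x0(1)] \<open>\<rho> > 0\<close> by (auto simp: h_def dist_norm norm_minus_commute)
  then have "x\<^sub>0 \<in> ball z \<rho>"
    using x0(1) by simp
  moreover have "h x - (h x\<^sub>0 - u x\<^sub>0) \<le> u x" if "x \<in> ball z \<rho>" for x
    using x0(2)[of x] that by simp
  ultimately show thesis
    using that[of x\<^sub>0 "h x\<^sub>0 - u x\<^sub>0"] le0 unfolding h_def by simp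
qed

lemma C2_paraboloid:
  fixes z :: "'a::euclidean_space"
  shows "C2_on_closure U (\<lambda>x. A * (1 - (norm (x - z) / \<rho>)\<^sup>2) - m)"
proof -
  define B b where "B = A / \<rho>\<^sup>2" and "b = - (2 * B)"
  have "has_grad_hess (\<lambda>x. A * (1 - (norm (x - z) / \<rho>)\<^sup>2) - m) (\<lambda>x. b *\<^sub>R (x - z)) (\<lambda>x. b *\<^sub>R id_blinfun) U"
    unfolding has_grad_hess_def
  proof (intro ballI conjI)
    fix x
    have "((\<lambda>x. A - B * ((x - z) \<bullet> (x - z)) - m) has_derivative (\<lambda>h. b *\<^sub>R (x - z) \<bullet> h)) (at x)"
      by (auto intro!: derivative_eq_intros simp: b_def inner_commute algebra_simps)
    then show "((\<lambda>x. A * (1 - (norm (x - z) / \<rho>)\<^sup>2) - m) has_derivative (\<lambda>h. b *\<^sub>R (x - z) \<bullet> h)) (at x)"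
      by (simp add: B_def power_divide power2_norm_eq_inner right_diff_distrib)
    show "((\<lambda>x. b *\<^sub>R (x - z)) has_derivative blinfun_apply (b *\<^sub>R id_blinfun)) (at x)"
      by (auto intro!: derivative_eq_intros simp: scaleR_blinfun.rep_eq)
  qed
  \<comment> \<open>For \<rho> = 0 division by zero yields 0, so the function is constant.\<close>
  moreover have "continuous_on (closure U) (\<lambda>x. A * (1 - (norm (x - z) / \<rho>)\<^sup>2) - m)"
    by (cases "\<rho> = 0") (auto intro!: continuous_intros)
  moreover have "continuous_on (closure U) (\<lambda>x. b *\<^sub>R (x - z))"
    by (intro continuous_intros)
  ultimately show ?thesis
    unfolding C2_on_closure_def using continuous_on_const by blast
qed

section \<open>Integral estimates for the directional operators\<close>

text \<open>This covers non-integrable \<open>f\<close>, whose integral is \<open>0\<close>.\<close>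

lemma set_integral_le_nonneg:
  fixes f g :: "'a \<Rightarrow> real"
  assumes "set_integrable M S g" "\<And>x. x \<in> S \<Longrightarrow> 0 \<le> g x" "\<And>x. x \<in> S \<Longrightarrow> f x \<le> g x"
  shows "(LINT x:S|M. f x) \<le> (LINT x:S|M. g x)"
proof (cases "set_integrable M S f")
  case True
  then show ?thesis
    using assms set_integral_mono by blast
next
  case False
  then have "(LINT x:S|M. f x) = 0"
    by (simp add: set_integrable_def set_lebesgue_integral_def not_integrable_integral_eq)
  then show ?thesis
    using assms by (simp add: set_lebesgue_integral_def split: split_indicator)
qed

text \<open>The mirror image, applied to \<open>- f\<close>: the default value 0 of a non-integrable
  \<open>f\<close> stays above the nonpositive left side. The operators can thus be estimated from
  pointwise bounds on their integrands alone.\<close>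

lemma set_integral_ge_nonpos:
  fixes f g :: "'a \<Rightarrow> real"
  assumes "set_integrable M S g" "\<And>x. x \<in> S \<Longrightarrow> 0 \<le> g x" "\<And>x. x \<in> S \<Longrightarrow> - g x \<le> f x"
  shows "- (LINT x:S|M. g x) \<le> (LINT x:S|M. f x)"
proof -
  have "(LINT x:S|M. - f x) \<le> (LINT x:S|M. g x)"
    using assms by (intro set_integral_le_nonneg) force+
  then show ?thesis
    by (simp add: set_lebesgue_integral_def)
qed

text \<open>A bridge from gauge integrals, for which the integrals of powers are computed, to the
  Lebesgue integral in \<open>frac_dir\<close>. For nonnegative functions gauge integrability is
  already absolute.\<close>

lemma set_integral_nonneg_has_integral:
  fixes g :: "'a::euclidean_space \<Rightarrow> real"
  assumes "(g has_integral I) S" "\<And>x. x \<in> S \<Longrightarrow> 0 \<le> g x"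
  shows "set_integrable lebesgue S g" "(LINT x:S|lebesgue. g x) = I"
proof -
  show "set_integrable lebesgue S g"
    using assms by (intro nonnegative_absolutely_integrable_1) (auto simp: has_integral_integrable)
  then show "(LINT x:S|lebesgue. g x) = I"
    using set_lebesgue_integral_eq_integral(2) assms(1) integral_unique by metis
qed

text \<open>The minimum switches at \<rho>. Below it the integrand is a multiple of
  \<open>\<tau> powr (1 - 2 * s)\<close>, integrable at 0 since s < 1; above it is
  \<open>\<tau> powr (- 1 - 2 * s)\<close>, integrable at infinity since s > 0. The two pieces give
  the two fractions.\<close>

lemma has_integral_truncated_kernel:
  fixes s \<rho> :: real
  assumes "0 < s" "s < 1" "\<rho> > 0"
  shows "((\<lambda>\<tau>. min 1 ((\<tau> / \<rho>)\<^sup>2) / \<tau> powr (1 + 2 * s)) has_integral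
           (1 / (2 - 2 * s) + 1 / (2 * s)) * \<rho> powr (- (2 * s))) {0<..}"
    (is "(?f has_integral _) _")
proof -
  have "((\<lambda>\<tau>. \<tau> powr (1 - 2 * s) / \<rho>\<^sup>2) has_integral (\<rho> powr (1 - 2 * s + 1) / (1 - 2 * s + 1)) / \<rho>\<^sup>2) {0..\<rho>}"
    using assms by (intro has_integral_divide has_integral_powr_from_0) auto
  moreover have "\<tau> powr (1 - 2 * s) / \<rho>\<^sup>2 = ?f \<tau>" if "\<tau> \<in> {0..\<rho>}" for \<tau>
  proof (cases "\<tau> = 0")
    case False
    then have "0 < \<tau>" "(\<tau> / \<rho>)\<^sup>2 \<le> 1"
      using that assms by (auto intro!: power_le_one)
    have "\<tau> powr (1 - 2 * s) = \<tau> powr 2 / \<tau> powr (1 + 2 * s)"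
      by (simp flip: powr_diff)
    then show ?thesis
      using \<open>0 < \<tau>\<close> \<open>(\<tau> / \<rho>)\<^sup>2 \<le> 1\<close> by (simp add: min_absorb2 power_divide)
  qed simp
  ultimately have 1: "(?f has_integral (\<rho> powr (1 - 2 * s + 1) / (1 - 2 * s + 1)) / \<rho>\<^sup>2) {0..\<rho>}"
    using has_integral_cong by (metis (no_types, lifting))
  have "((\<lambda>\<tau>. \<tau> powr (- 1 - 2 * s)) has_integral - (\<rho> powr (- 1 - 2 * s + 1)) / (- 1 - 2 * s + 1)) {\<rho>..}"
    using assms by (intro has_integral_powr_to_inf) auto
  moreover have "\<tau> powr (- 1 - 2 * s) = ?f \<tau>" if "\<tau> \<in> {\<rho>..}" for \<tau>
  proof -
    have "1 \<le> (\<tau> / \<rho>)\<^sup>2"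
      using that assms by (simp add: one_le_power)
    moreover have "\<tau> powr (- 1 - 2 * s) = 1 / \<tau> powr (1 + 2 * s)"
      using powr_minus_divide[of \<tau> "1 + 2 * s"] by simp
    ultimately show ?thesis
      by simp
  qed
  ultimately have 2: "(?f has_integral - (\<rho> powr (- 1 - 2 * s + 1)) / (- 1 - 2 * s + 1)) {\<rho>..}"
    using has_integral_cong by (metis (no_types, lifting))
  have "{0..\<rho>} \<inter> {\<rho>..} = {\<rho>}" "{0..\<rho>} \<union> {\<rho>..} = {0..}"
    using assms by auto
  then have 3: "(?f has_integral ((\<rho> powr (1 - 2 * s + 1) / (1 - 2 * s + 1)) / \<rho>\<^sup>2
      + - (\<rho> powr (- 1 - 2 * s + 1)) / (- 1 - 2 * s + 1))) {0..}"
    using has_integral_Un[OF 1 2] by simp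
  have "\<rho> powr (2 - 2 * s) / \<rho>\<^sup>2 = \<rho> powr (- (2 * s))"
    using assms by (simp add: powr_diff powr_minus_divide)
  then have "(\<rho> powr (1 - 2 * s + 1) / (1 - 2 * s + 1)) / \<rho>\<^sup>2
      + - (\<rho> powr (- 1 - 2 * s + 1)) / (- 1 - 2 * s + 1)
      = (1 / (2 - 2 * s) + 1 / (2 * s)) * \<rho> powr (- (2 * s))"
    using assms by (simp add: field_simps)
  with 3 have "(?f has_integral (1 / (2 - 2 * s) + 1 / (2 * s)) * \<rho> powr (- (2 * s))) {0..}"
    by simp
  \<comment> \<open>The two half-lines differ only in the point 0, where the integrand is 0.\<close>
  moreover have "{x \<in> {0..} - {0<..}. ?f x \<noteq> 0} = {}" "{x \<in> {0<..} - {0..}. ?f x \<noteq> 0} = {}"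
    by auto
  ultimately show ?thesis
    using has_integral_spike_set_eq[where f = ?f and S = "{0..}" and T = "{0<..}"]
    by (simp only: negligible_empty simp_thms)
qed

lemma frac_dir_lower_bound:
  assumes "0 < s" "s < 1" "\<rho> > 0" "c \<ge> 0" "A \<ge> 0"
    and v: "\<And>\<tau>. 0 < \<tau> \<Longrightarrow> - 2 * A * min 1 ((\<tau> / \<rho>)\<^sup>2) \<le> v (x + \<tau> *\<^sub>R \<xi>) + v (x - \<tau> *\<^sub>R \<xi>) - 2 * v x"
  shows "- c * (2 * A) * (1 / (2 - 2 * s) + 1 / (2 * s)) * \<rho> powr (- (2 * s)) \<le> frac_dir c s \<xi> v x"
proof -
  define k where "k \<tau> = 2 * A * (min 1 ((\<tau> / \<rho>)\<^sup>2) / \<tau> powr (1 + 2 * s))" for \<tau>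
  have "(k has_integral 2 * A * ((1 / (2 - 2 * s) + 1 / (2 * s)) * \<rho> powr (- (2 * s)))) {0<..}"
    unfolding k_def by (intro has_integral_mult_right has_integral_truncated_kernel assms)
  moreover have "0 \<le> k \<tau>" for \<tau>
    using assms by (simp add: k_def)
  ultimately have k: "set_integrable lebesgue {0<..} k"
    "(LINT \<tau>:{0<..}|lebesgue. k \<tau>) = 2 * A * ((1 / (2 - 2 * s) + 1 / (2 * s)) * \<rho> powr (- (2 * s)))"
    using set_integral_nonneg_has_integral by blast+
  have "- k \<tau> \<le> (v (x + \<tau> *\<^sub>R \<xi>) + v (x - \<tau> *\<^sub>R \<xi>) - 2 * v x) / \<tau> powr (1 + 2 * s)" if "\<tau> > 0" for \<tau>
    using divide_right_mono[OF v[OF that], of "\<tau> powr (1 + 2 * s)"] by (simp add: k_def)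
  then have "- (LINT \<tau>:{0<..}|lebesgue. k \<tau>)
      \<le> (LINT \<tau>:{0<..}|lebesgue. (v (x + \<tau> *\<^sub>R \<xi>) + v (x - \<tau> *\<^sub>R \<xi>) - 2 * v x) / \<tau> powr (1 + 2 * s))"
    using k(1) \<open>\<And>\<tau>. 0 \<le> k \<tau>\<close> by (intro set_integral_ge_nonpos) auto
  from mult_left_mono[OF this \<open>c \<ge> 0\<close>] show ?thesis
    unfolding frac_dir_def k(2) by (simp only: mult_minus_left mult_minus_right mult_ac)
qed

text \<open>Near \<open>x\<close> the second differences contribute nothing positive, and far away
  growth of order a < 2s is integrable against the kernel. The bound serves only to make the real
  supremum in \<open>frac_sup\<close> one over a set bounded above; its size is immaterial.\<close>

lemma frac_dir_upper_bound:
  assumes "a < 2 * s" "r > 0" "c \<ge> 0" "D \<ge> 0"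
    and near: "\<And>\<tau>. 0 < \<tau> \<Longrightarrow> \<tau> < r \<Longrightarrow> v (x + \<tau> *\<^sub>R \<xi>) + v (x - \<tau> *\<^sub>R \<xi>) - 2 * v x \<le> 0"
    and far: "\<And>\<tau>. r \<le> \<tau> \<Longrightarrow> v (x + \<tau> *\<^sub>R \<xi>) + v (x - \<tau> *\<^sub>R \<xi>) - 2 * v x \<le> D * \<tau> powr a"
  shows "frac_dir c s \<xi> v x \<le> c * D * (r powr (a - 2 * s) / (2 * s - a))"
proof -
  define k where "k \<tau> = (if \<tau> \<in> {r..} then D * \<tau> powr (a - 2 * s - 1) else 0)" for \<tau>
  have "((\<lambda>\<tau>. \<tau> powr (a - 2 * s - 1)) has_integral
      - (r powr (a - 2 * s - 1 + 1)) / (a - 2 * s - 1 + 1)) {r..}"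
    using assms by (intro has_integral_powr_to_inf) auto
  also have "- (r powr (a - 2 * s - 1 + 1)) / (a - 2 * s - 1 + 1) = r powr (a - 2 * s) / (2 * s - a)"
    using assms by (simp add: field_simps)
  finally have "((\<lambda>\<tau>. D * \<tau> powr (a - 2 * s - 1)) has_integral D * (r powr (a - 2 * s) / (2 * s - a))) {r..}"
    by (rule has_integral_mult_right)
  then have "(k has_integral D * (r powr (a - 2 * s) / (2 * s - a))) {0<..}"
    unfolding k_def using \<open>r > 0\<close> by (subst has_integral_restrict) auto
  moreover have k_nonneg: "0 \<le> k \<tau>" for \<tau>
    using assms by (simp add: k_def)
  ultimately have k: "set_integrable lebesgue {0<..} k"
    "(LINT \<tau>:{0<..}|lebesgue. k \<tau>) = D * (r powr (a - 2 * s) / (2 * s - a))"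
    using set_integral_nonneg_has_integral by blast+
  have "(v (x + \<tau> *\<^sub>R \<xi>) + v (x - \<tau> *\<^sub>R \<xi>) - 2 * v x) / \<tau> powr (1 + 2 * s) \<le> k \<tau>" if "\<tau> > 0" for \<tau>
  proof (cases "\<tau> < r")
    case True
    then show ?thesis
      using near[OF that] by (simp add: k_def divide_nonpos_nonneg)
  next
    case False
    have "(v (x + \<tau> *\<^sub>R \<xi>) + v (x - \<tau> *\<^sub>R \<xi>) - 2 * v x) / \<tau> powr (1 + 2 * s)
        \<le> D * \<tau> powr a / \<tau> powr (1 + 2 * s)"
      using False by (intro divide_right_mono far) auto
    also have "\<dots> = D * \<tau> powr (a - 2 * s - 1)"
      by (simp add: diff_diff_eq add.commute flip: powr_diff times_divide_eq_right)
    finally show ?thesis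
      using False by (simp add: k_def)
  qed
  then have "(LINT \<tau>:{0<..}|lebesgue. (v (x + \<tau> *\<^sub>R \<xi>) + v (x - \<tau> *\<^sub>R \<xi>) - 2 * v x) / \<tau> powr (1 + 2 * s))
      \<le> (LINT \<tau>:{0<..}|lebesgue. k \<tau>)"
    using k(1) k_nonneg by (intro set_integral_le_nonneg) auto
  from mult_left_mono[OF this \<open>c \<ge> 0\<close>] show ?thesis
    by (simp add: frac_dir_def k(2) mult_ac)
qed

section \<open>From single directions to the extremal operators\<close>

lemma orthonormal_families_nonempty:
  assumes "k \<le> DIM('a::euclidean_space)"
  shows "orthonormal_families k \<noteq> ({} :: 'a set set)"
proof -
  obtain B :: "'a set" where B: "B \<subseteq> Basis" "card B = k" "finite B"
    using obtain_subset_with_card_n[OF assms] by metis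
  then have "B \<in> orthonormal_families k"
    unfolding orthonormal_families_def pairwise_def orthogonal_def
    by (auto simp: inner_not_same_Basis subset_eq)
  then show ?thesis
    by blast
qed

text \<open>A sum over a family has \<open>k\<close> terms, each at least \<open>L\<close>. For the
  infimum this must hold for every family, while one family suffices for the supremum, once the
  uniform upper bound \<open>M\<close> makes the supremum in the reals dominate its members.\<close>

lemma
  fixes v :: "'a::euclidean_space \<Rightarrow> real"
  assumes "k \<le> DIM('a)" and lower: "\<And>\<xi>. norm \<xi> = 1 \<Longrightarrow> L \<le> frac_dir c s \<xi> v x"
  shows frac_inf_lower_bound: "k * L \<le> frac_inf c s k v x"
    and frac_sup_lower_bound: "(\<And>\<xi>. norm \<xi> = 1 \<Longrightarrow> frac_dir c s \<xi> v x \<le> M) \<Longrightarrow> k * L \<le> frac_sup c s k v x"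
proof -
  have sum_lower: "k * L \<le> (\<Sum>\<xi>\<in>B. frac_dir c s \<xi> v x)" if "B \<in> orthonormal_families k" for B
    using that sum_bounded_below[of B L "\<lambda>\<xi>. frac_dir c s \<xi> v x"] lower by (auto simp: orthonormal_families_def)
  then show "k * L \<le> frac_inf c s k v x"
    unfolding frac_inf_def by (intro cINF_greatest orthonormal_families_nonempty assms)
  show "k * L \<le> frac_sup c s k v x" if upper: "\<And>\<xi>. norm \<xi> = 1 \<Longrightarrow> frac_dir c s \<xi> v x \<le> M"
  proof -
    obtain B :: "'a set" where B: "B \<in> orthonormal_families k"
      using orthonormal_families_nonempty assms(1) by blast
    have "(\<Sum>\<xi>\<in>B. frac_dir c s \<xi> v x) \<le> k * M" if "B \<in> orthonormal_families k" for B
      using that sum_bounded_above[of B "\<lambda>\<xi>. frac_dir c s \<xi> v x" M] upper by (auto simp: orthonormal_families_def)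
    then have "bdd_above ((\<lambda>B. \<Sum>\<xi>\<in>B. frac_dir c s \<xi> v x) ` orthonormal_families k)"
      by (intro bdd_aboveI2)
    then show ?thesis
      unfolding frac_sup_def using B sum_lower[OF B] by (rule cSUP_upper2)
  qed
qed

section \<open>The inequality at the touching point\<close>

text \<open>By the parallelogram law the two squared distances add up to twice that of
  \<open>x\<close> plus 2\<tau>^2, so neither the base point nor the shift \<open>m\<close>
  survives.\<close>

lemma paraboloid_second_difference:
  fixes x \<xi> z :: "'a::real_inner"
    and A \<rho> m \<tau> :: real
  assumes "norm \<xi> = 1"
  defines "P \<equiv> \<lambda>y. A * (1 - (norm (y - z) / \<rho>)\<^sup>2) - m"
  shows "P (x + \<tau> *\<^sub>R \<xi>) + P (x - \<tau> *\<^sub>R \<xi>) - 2 * P x = - 2 * A * (\<tau> / \<rho>)\<^sup>2"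
proof -
  have "(norm (x + \<tau> *\<^sub>R \<xi> - z))\<^sup>2 + (norm (x - \<tau> *\<^sub>R \<xi> - z))\<^sup>2 = 2 * (norm (x - z))\<^sup>2 + 2 * \<tau>\<^sup>2"
    using assms(1) unfolding power2_norm_eq_inner norm_eq_1
    by (simp add: inner_commute algebra_simps power2_eq_square)
  then have "(norm (x + \<tau> *\<^sub>R \<xi> - z))\<^sup>2 = 2 * (norm (x - z))\<^sup>2 + 2 * \<tau>\<^sup>2 - (norm (x - \<tau> *\<^sub>R \<xi> - z))\<^sup>2"
    by simp
  then show ?thesis
    by (simp add: P_def power_divide diff_divide_distrib add_divide_distrib right_diff_distrib distrib_left)
qed

text \<open>The test function \<psi> dominates the paraboloid and meets it at the touching point, so
  its second differences there dominate the explicit ones. The result keeps the dependence on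
  \<open>A\<close> and \<rho> visible so that both can later vary with the scale.\<close>

lemma supersolution_scale_bound:
  fixes u :: "(real^'m) \<times> real \<Rightarrow> real" and z :: "(real^'m) \<times> real"
  assumes "0 < s" "s < 1" "p \<le> 0" "c > 0"
    and k: "k \<le> DIM((real^'m) \<times> real)"
    and \<I>: "\<I> = frac_sup c s k \<or> \<I> = frac_inf c s k"
    and u: "u \<in> LSC half_space" "u \<in> growth_space s" "\<And>x. 0 \<le> u x" "\<And>x. x \<in> half_space \<Longrightarrow> 0 < u x"
    and super: "viscosity_supersolution \<I> p u"
    and "\<rho> > 0" and ball: "cball z \<rho> \<subseteq> half_space" and A: "\<And>x. x \<in> cball z \<rho> \<Longrightarrow> u x \<le> A"
  shows "A powr p \<le> k * (c * (2 * A) * (1 / (2 - 2 * s) + 1 / (2 * s)) * \<rho> powr (- (2 * s)))"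
proof -
  define P where "P m x = A * (1 - (norm (x - z) / \<rho>)\<^sup>2) - m" for m x
  obtain x\<^sub>0 m where x0: "x\<^sub>0 \<in> ball z \<rho>" "m \<ge> 0" "u x\<^sub>0 = P m x\<^sub>0"
    and P_le: "\<And>x. x \<in> ball z \<rho> \<Longrightarrow> P m x \<le> u x"
    using touching_paraboloid[OF u(1) ball \<open>\<rho> > 0\<close>, of A] u(4) ball A \<open>\<rho> > 0\<close>
    unfolding P_def by (auto simp: subset_eq)
  have ux0: "0 < u x\<^sub>0" "u x\<^sub>0 \<le> A"
    using x0(1) u(4) ball A by (auto simp: subset_eq)
  then have "A > 0" by simp
  \<comment> \<open>Requiring r \<le> \<rho> ensures that points at distance at least \<rho> from
    \<open>x\<^sub>0\<close> lie where \<psi> is \<open>u\<close>, hence nonnegative.\<close>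
  obtain r where "r > 0" and r: "ball x\<^sub>0 r \<subseteq> ball z \<rho>" and "r \<le> \<rho>"
  proof -
    obtain e where "e > 0" "ball x\<^sub>0 e \<subseteq> ball z \<rho>"
      using x0(1) open_ball open_contains_ball by metis
    then show thesis
      using that[of "min e \<rho>"] \<open>\<rho> > 0\<close> subset_ball[of "min e \<rho>" e x\<^sub>0] by simp
  qed
  define \<psi> where "\<psi> x = (if x \<in> ball x\<^sub>0 r then P m x else u x)" for x
  have "ball x\<^sub>0 r \<subseteq> half_space" "x\<^sub>0 \<in> half_space"
    using r ball x0(1) by (auto simp: subset_eq)
  moreover have "C2_on_closure (ball x\<^sub>0 r) (P m)"
    unfolding P_def by (rule C2_paraboloid)
  moreover have "P m x\<^sub>0 = u x\<^sub>0" "\<forall>x\<in>ball x\<^sub>0 r. P m x \<le> u x"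
    using x0(3) P_le r by (auto simp: subset_eq)
  ultimately have ineq: "\<I> \<psi> x\<^sub>0 + u x\<^sub>0 powr p \<le> 0"
    using super \<open>r > 0\<close> unfolding viscosity_supersolution_def \<psi>_def by blast
  have \<psi>_x0: "\<psi> x\<^sub>0 = P m x\<^sub>0"
    using \<open>r > 0\<close> by (simp add: \<psi>_def)
  have P_nonpos: "P m x \<le> 0" if "x \<notin> ball z \<rho>" for x
  proof -
    have "1 \<le> norm (x - z) / \<rho>"
      using that \<open>\<rho> > 0\<close> by (simp add: dist_norm norm_minus_commute)
    then have "1 \<le> (norm (x - z) / \<rho>)\<^sup>2"
      by (rule one_le_power)
    then have "A * (1 - (norm (x - z) / \<rho>)\<^sup>2) \<le> 0"
      using \<open>A > 0\<close> by (simp add: mult_nonneg_nonpos)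
    then show ?thesis
      using \<open>m \<ge> 0\<close> by (simp add: P_def)
  qed
  have P_le_\<psi>: "P m x \<le> \<psi> x" for x
    using P_le[of x] P_nonpos[of x] u(3)[of x] by (cases "x \<in> ball z \<rho>") (auto simp: \<psi>_def)
  define L where "L = - c * (2 * A) * (1 / (2 - 2 * s) + 1 / (2 * s)) * \<rho> powr (- (2 * s))"
  have lower: "L \<le> frac_dir c s \<xi> \<psi> x\<^sub>0" if \<xi>: "norm \<xi> = 1" for \<xi>
    unfolding L_def
  proof (rule frac_dir_lower_bound)
    fix \<tau> :: real assume "0 < \<tau>"
    show "- 2 * A * min 1 ((\<tau> / \<rho>)\<^sup>2) \<le> \<psi> (x\<^sub>0 + \<tau> *\<^sub>R \<xi>) + \<psi> (x\<^sub>0 - \<tau> *\<^sub>R \<xi>) - 2 * \<psi> x\<^sub>0"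
    proof (cases "\<tau> < \<rho>")
      case True
      then have "(\<tau> / \<rho>)\<^sup>2 \<le> 1"
        using \<open>0 < \<tau>\<close> by (intro power_le_one) auto
      then have "- 2 * A * min 1 ((\<tau> / \<rho>)\<^sup>2) = P m (x\<^sub>0 + \<tau> *\<^sub>R \<xi>) + P m (x\<^sub>0 - \<tau> *\<^sub>R \<xi>) - 2 * P m x\<^sub>0"
        unfolding P_def using paraboloid_second_difference[OF \<xi>] by (simp add: min_absorb2)
      then show ?thesis
        using P_le_\<psi>[of "x\<^sub>0 + \<tau> *\<^sub>R \<xi>"] P_le_\<psi>[of "x\<^sub>0 - \<tau> *\<^sub>R \<xi>"] \<psi>_x0 by linarith
    next
      \<comment> \<open>Beyond \<rho> the quadratic bound is replaced by the constant -2A: both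
        outer values are nonnegative, and the central value is at most \<open>A\<close>.\<close>
      case False
      then have "0 \<le> \<psi> (x\<^sub>0 + \<tau> *\<^sub>R \<xi>)" "0 \<le> \<psi> (x\<^sub>0 - \<tau> *\<^sub>R \<xi>)"
        using \<open>r \<le> \<rho>\<close> \<xi> u(3) \<open>0 < \<tau>\<close> by (auto simp: \<psi>_def dist_norm)
      moreover have "1 \<le> (\<tau> / \<rho>)\<^sup>2"
        using False \<open>\<rho> > 0\<close> by (intro one_le_power) simp
      ultimately show ?thesis
        using \<psi>_x0 x0(3) ux0(2) by (simp add: min_absorb1)
    qed
  qed (use assms \<open>A > 0\<close> in auto)
  obtain a C' where a: "0 \<le> a" "a < 2 * s" "C' > 0" "\<And>x. \<bar>u x\<bar> \<le> C' * (1 + norm x) powr a"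
    using u(2) by (auto simp: growth_space_def)
  \<comment> \<open>If y has distance \<tau> \<ge> r from \<open>x\<^sub>0\<close>, then 1 + |y| is
    at most ((1 + |\<open>x\<^sub>0\<close>|) / r + 1) \<tau>. The factor 2 counts the two outer
    points; the negative central term is dropped.\<close>
  define D where "D = 2 * C' * ((1 + norm x\<^sub>0) / r + 1) powr a"
  have upper: "frac_dir c s \<xi> \<psi> x\<^sub>0 \<le> c * D * (r powr (a - 2 * s) / (2 * s - a))" if \<xi>: "norm \<xi> = 1" for \<xi>
  proof (rule frac_dir_upper_bound)
    fix \<tau> :: real assume "0 < \<tau>" "\<tau> < r"
    then have "\<psi> (x\<^sub>0 + \<tau> *\<^sub>R \<xi>) = P m (x\<^sub>0 + \<tau> *\<^sub>R \<xi>)" "\<psi> (x\<^sub>0 - \<tau> *\<^sub>R \<xi>) = P m (x\<^sub>0 - \<tau> *\<^sub>R \<xi>)"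
      using \<xi> by (auto simp: \<psi>_def dist_norm)
    then have "\<psi> (x\<^sub>0 + \<tau> *\<^sub>R \<xi>) + \<psi> (x\<^sub>0 - \<tau> *\<^sub>R \<xi>) - 2 * \<psi> x\<^sub>0 = - 2 * A * (\<tau> / \<rho>)\<^sup>2"
      using \<psi>_x0 paraboloid_second_difference[OF \<xi>] by (simp add: P_def)
    then show "\<psi> (x\<^sub>0 + \<tau> *\<^sub>R \<xi>) + \<psi> (x\<^sub>0 - \<tau> *\<^sub>R \<xi>) - 2 * \<psi> x\<^sub>0 \<le> 0"
      using \<open>A > 0\<close> by simp
  next
    fix \<tau> assume "r \<le> \<tau>"
    have far: "u y \<le> C' * (((1 + norm x\<^sub>0) / r + 1) powr a * \<tau> powr a)" if "norm (y - x\<^sub>0) = \<tau>" for y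
    proof -
      have "norm y \<le> norm x\<^sub>0 + \<tau>"
        using norm_triangle_ineq[of x\<^sub>0 "y - x\<^sub>0"] that by simp
      moreover have "1 + norm x\<^sub>0 \<le> (1 + norm x\<^sub>0) * (\<tau> / r)"
        using mult_left_mono[of 1 "\<tau> / r" "1 + norm x\<^sub>0"] \<open>r \<le> \<tau>\<close> \<open>r > 0\<close> by simp
      ultimately have "1 + norm y \<le> ((1 + norm x\<^sub>0) / r + 1) * \<tau>"
        by (simp add: algebra_simps add_divide_distrib)
      then have "(1 + norm y) powr a \<le> (((1 + norm x\<^sub>0) / r + 1) * \<tau>) powr a"
        using a(1) by (intro powr_mono2) auto
      also have "\<dots> = ((1 + norm x\<^sub>0) / r + 1) powr a * \<tau> powr a"
        by (rule powr_mult)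
      finally show ?thesis
        using a(3) a(4)[of y] by (meson abs_le_D1 mult_left_mono less_imp_le order_trans)
    qed
    have "\<psi> (x\<^sub>0 + \<tau> *\<^sub>R \<xi>) = u (x\<^sub>0 + \<tau> *\<^sub>R \<xi>)" "\<psi> (x\<^sub>0 - \<tau> *\<^sub>R \<xi>) = u (x\<^sub>0 - \<tau> *\<^sub>R \<xi>)"
      using \<xi> \<open>r \<le> \<tau>\<close> \<open>r > 0\<close> by (auto simp: \<psi>_def dist_norm)
    then show "\<psi> (x\<^sub>0 + \<tau> *\<^sub>R \<xi>) + \<psi> (x\<^sub>0 - \<tau> *\<^sub>R \<xi>) - 2 * \<psi> x\<^sub>0 \<le> D * \<tau> powr a"
      using far[of "x\<^sub>0 + \<tau> *\<^sub>R \<xi>"] far[of "x\<^sub>0 - \<tau> *\<^sub>R \<xi>"] \<xi> \<open>r \<le> \<tau>\<close> \<open>r > 0\<close> \<psi>_x0 x0(3) ux0(1)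
      by (simp add: D_def)
  qed (use assms a \<open>r > 0\<close> in \<open>auto simp: D_def\<close>)
  have "k * L \<le> \<I> \<psi> x\<^sub>0"
    using \<I> frac_sup_lower_bound[OF k lower upper] frac_inf_lower_bound[OF k lower] by auto
  moreover have "A powr p \<le> u x\<^sub>0 powr p"
    using ux0 \<open>p \<le> 0\<close> by (intro powr_mono2') auto
  ultimately have "A powr p \<le> - (k * L)"
    using ineq by linarith
  then show ?thesis
    by (simp add: L_def)
qed

section \<open>Letting the radius grow\<close>

theorem theorem1p6:
  fixes s p C \<alpha> :: real and k :: nat and Cs :: "real \<Rightarrow> real"
    and \<I> :: "((real^'m) \<times> real \<Rightarrow> real) \<Rightarrow> (real^'m) \<times> real \<Rightarrow> real"
  assumes "0 < s" and "s < 1" and "p \<le> 0"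
    and "normalizing_constant TYPE((real^'m) \<times> real) Cs"
    and "1 \<le> k" and "k \<le> DIM((real^'m) \<times> real)"
    and "\<I> = frac_sup (Cs s) s k \<or> \<I> = frac_inf (Cs s) s k"
    and "C > 0" and "0 < \<alpha>" and "\<alpha> < 2 * s / (1 - p)"
  shows "\<nexists>u. u \<in> LSC half_space \<inter> growth_space s \<and>
              (\<forall>x. x \<notin> half_space \<longrightarrow> u x \<ge> 0) \<and>
              (\<forall>x\<in>half_space. 0 < u x \<and> u x \<le> C * (1 + norm x) powr \<alpha>) \<and>
              viscosity_supersolution \<I> p u"
proof
  assume "\<exists>u. u \<in> LSC half_space \<inter> growth_space s \<and>
              (\<forall>x. x \<notin> half_space \<longrightarrow> u x \<ge> 0) \<and>
              (\<forall>x\<in>half_space. 0 < u x \<and> u x \<le> C * (1 + norm x) powr \<alpha>) \<and>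
              viscosity_supersolution \<I> p u"
  then obtain u where u: "u \<in> LSC half_space" "u \<in> growth_space s" "\<And>x. x \<notin> half_space \<Longrightarrow> u x \<ge> 0"
      "\<And>x. x \<in> half_space \<Longrightarrow> 0 < u x" "\<And>x. x \<in> half_space \<Longrightarrow> u x \<le> C * (1 + norm x) powr \<alpha>"
      "viscosity_supersolution \<I> p u"
    by blast
  have nonneg: "0 \<le> u x" for x
    using u(3,4) by (meson less_imp_le)
  have "Cs s > 0"
    using assms by (simp add: normalizing_constant_def)
  \<comment> \<open>The surplus of the decay exponent 2s over the growth exponent \<alpha>(1 - p);
    it is positive exactly by the assumed bound on \<alpha>.\<close>
  define \<beta> where "\<beta> = 2 * s - \<alpha> * (1 - p)"
  have "\<beta> > 0"
    using assms by (simp add: \<beta>_def pos_less_divide_eq)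
  \<comment> \<open>\<open>E\<close> and \<open>F\<close> collect the factors independent of
    \<open>R\<close> after setting \<rho> = R/2 and A = C (3R)^\<alpha> in the scale bound.\<close>
  define E where "E = k * (Cs s * 2 * (1 / (2 - 2 * s) + 1 / (2 * s)))"
  define F where "F = E * (1 / 2) powr (- (2 * s)) * (C * 3 powr \<alpha>) powr (1 - p)"
  have bound: "R powr \<beta> \<le> F" if "R \<ge> 1" for R
  proof -
    define z :: "(real^'m) \<times> real" where "z = (0, R)"
    \<comment> \<open>On the ball of radius R/2 about \<open>z\<close>, 1 + |x| \<le> 1 + 3R/2 \<le>
      3R because R \<ge> 1.\<close>
    define A where "A = C * (3 * R) powr \<alpha>"
    have "A > 0" "norm z = R"
      using that \<open>C > 0\<close> by (auto simp: A_def z_def)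
    have sub: "cball z (R / 2) \<subseteq> half_space"
    proof
      fix x assume "x \<in> cball z (R / 2)"
      then have "\<bar>R - snd x\<bar> \<le> R / 2"
        using dist_snd_le[of z x] by (simp add: z_def dist_real_def)
      then show "x \<in> half_space"
        using that unfolding half_space_def mem_Collect_eq by linarith
    qed
    have u_le: "u x \<le> A" if "x \<in> cball z (R / 2)" for x
    proof -
      have "norm x \<le> norm z + R / 2"
        using that norm_triangle_ineq2[of x z] by (simp add: dist_norm norm_minus_commute)
      then have "(1 + norm x) powr \<alpha> \<le> (3 * R) powr \<alpha>"
        using \<open>norm z = R\<close> \<open>R \<ge> 1\<close> \<open>0 < \<alpha>\<close> by (intro powr_mono2) auto
      then show ?thesis
        unfolding A_def using u(5)[of x] sub that \<open>C > 0\<close>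
        by (meson mult_left_mono less_imp_le order_trans subsetD)
    qed
    have "A powr p \<le> k * (Cs s * (2 * A) * (1 / (2 - 2 * s) + 1 / (2 * s)) * (R / 2) powr (- (2 * s)))"
      by (rule supersolution_scale_bound[OF assms(1-3) \<open>Cs s > 0\<close> assms(6,7) u(1,2) nonneg u(4,6)])
        (use that sub u_le in auto)
    then have le: "A powr p \<le> E * A * (R / 2) powr (- (2 * s))"
      by (simp add: E_def mult_ac)
    \<comment> \<open>Multiplying by \<open>A powr (- p)\<close> gathers all powers of
      \<open>A\<close> on one side, producing the exponent 1 - p.\<close>
    have E_le: "1 \<le> E * A powr (1 - p) * (R / 2) powr (- (2 * s))"
    proof -
      have "1 = A powr p * A powr (- p)"
        using \<open>A > 0\<close> by (simp flip: powr_add)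
      also have "\<dots> \<le> E * A * (R / 2) powr (- (2 * s)) * A powr (- p)"
        using le by (intro mult_right_mono) auto
      also have "\<dots> = E * (A powr 1 * A powr (- p)) * (R / 2) powr (- (2 * s))"
        using \<open>A > 0\<close> by simp
      also have "A powr 1 * A powr (- p) = A powr (1 - p)"
        by (simp only: add_uminus_conv_diff flip: powr_add)
      finally show ?thesis .
    qed
    have "A powr (1 - p) = (C * 3 powr \<alpha>) powr (1 - p) * R powr (\<alpha> * (1 - p))"
      using that \<open>C > 0\<close> by (simp add: A_def powr_mult powr_powr)
    moreover have "(R / 2) powr (- (2 * s)) = R powr (- (2 * s)) * (1 / 2) powr (- (2 * s))"
      using that powr_mult[of R "1/2" "- (2 * s)"] by simp
    ultimately have "1 \<le> F * (R powr (\<alpha> * (1 - p)) * R powr (- (2 * s)))"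
      using E_le by (simp add: F_def mult_ac)
    also have "R powr (\<alpha> * (1 - p)) * R powr (- (2 * s)) = R powr (- \<beta>)"
      by (simp add: \<beta>_def flip: powr_add)
    finally show ?thesis
      using that by (simp add: powr_minus_divide field_simps)
  qed
  \<comment> \<open>Chosen so that \<open>R powr \<beta>\<close> is 1 + |F|, which exceeds
    \<open>F\<close>; the base is at least 1, hence so is \<open>R\<close>.\<close>
  define R where "R = (1 + \<bar>F\<bar>) powr (1 / \<beta>)"
  have "R \<ge> 1"
    using \<open>\<beta> > 0\<close> by (simp add: R_def ge_one_powr_ge_zero)
  moreover have "R powr \<beta> = 1 + \<bar>F\<bar>"
    using \<open>\<beta> > 0\<close> by (simp add: R_def powr_powr)
  ultimately show False
    using bound by force
qed

end
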